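(* For every constant $e>0$, problem $\mathcal{W}(1,ed)$ admits a solution by algorithm $\mathrm{Naive}(s,r)$ with speeds $s=r=\sqrt{e/3}$ if $e<3$, and $s=r=1$ if $e\ge3$. The induced evacuation time on instance $d$ is $g(e)\,d$, where $g(e)=3\sqrt{3/e}$ for $e<3$ and $g(e)=3$ for $e\ge3$.
   Context: Two robots start at the origin of the infinite real line. An exit is placed at an unknown point at distance $d>0$ from the origin (either at $d$ or at $-d$; either placement is called an instance $d$). A robot finds the exit if and only if it walks over it. Robots may change speed and direction at any time, and communicate wirelessly: messages are transmitted instantaneously at any distance. The evacuation time is the time at which the last robot reaches the exit. A robot moving at constant speed $s$ over a segment of length $x$ uses energy $xs^2$, and energies of successive intervals add up. The makespan evacuation energy is the maximum of the two robots' energies used until both have reached the exit. Problem $\mathcal{W}(1,ed)$: minimize the evacuation time over algorithms using speeds at most $1$ whose makespan evacuation energy is at most $ed$ for every instance $d$ (the algorithm does not know $d$ but knows $e$). Algorithm $\mathrm{Naive}(s,r)$: the two robots move in opposite directions with speed $s$ until the exit is found; the finder announces "exit found" and halts; the other robot turns around and moves at speed $r$ until it reaches the exit. *)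

theory Defs
  imports Complex_Main
begin

datatype robot = Robot1 | Robot2

text \<open>
  A trajectory maps time to the position on the line.
  \<open>moves b p a c E\<close>: on the time interval \<open>[a, c]\<close> the trajectory \<open>p\<close> consists of finitely many
  stretches of constant velocity, of speed at most \<open>b\<close>, and uses energy \<open>E\<close> in total. A stretch of
  length \<open>x\<close> covered at speed \<open>s\<close> costs \<open>x * s\<^sup>2\<close>; waiting (speed \<open>0\<close>) is free.
\<close>
inductive moves :: "real \<Rightarrow> (real \<Rightarrow> real) \<Rightarrow> real \<Rightarrow> real \<Rightarrow> real \<Rightarrow> bool"
  for b :: real and p :: "real \<Rightarrow> real" where
  const: "a \<le> c \<Longrightarrow> \<bar>v\<bar> \<le> b \<Longrightarrow> (\<And>t. a \<le> t \<Longrightarrow> t \<le> c \<Longrightarrow> p t = p a + v * (t - a)) \<Longrightarrow>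
    moves b p a c (\<bar>p c - p a\<bar> * \<bar>v\<bar>\<^sup>2)"
| add: "moves b p a m E \<Longrightarrow> moves b p m c F \<Longrightarrow> moves b p a c (E + F)"

definition trajectory :: "real \<Rightarrow> (real \<Rightarrow> real) \<Rightarrow> bool" where
  "trajectory b p \<longleftrightarrow> p 0 = 0 \<and> (\<forall>T\<ge>0. \<exists>E. moves b p 0 T E)"

text \<open>
  \<open>search A i t\<close> is the position of robot \<open>i\<close> at time \<open>t\<close> as long as the exit has not been found.
  \<open>respond A y i u\<close> is its position \<open>u\<close> time units after the announcement that the exit was found
  at \<open>y\<close>. As messages are instantaneous, both robots may react to \<open>y\<close> from the time of discovery
  on; before it, their motion cannot depend on \<open>y\<close>.
\<close>
record algorithm =
  search :: "robot \<Rightarrow> real \<Rightarrow> real"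
  respond :: "real \<Rightarrow> robot \<Rightarrow> real \<Rightarrow> real"

definition find_time :: "algorithm \<Rightarrow> real \<Rightarrow> real" where
  "find_time A y = Inf {t. 0 \<le> t \<and> (\<exists>i. search A i t = y)}"

definition run :: "algorithm \<Rightarrow> real \<Rightarrow> robot \<Rightarrow> real \<Rightarrow> real" where
  "run A y i t =
     (if t \<le> find_time A y then search A i t else respond A y i (t - find_time A y))"

definition reach_time :: "algorithm \<Rightarrow> real \<Rightarrow> robot \<Rightarrow> real" where
  "reach_time A y i = Inf {t. 0 \<le> t \<and> run A y i t = y}"

definition evacuation_time :: "algorithm \<Rightarrow> real \<Rightarrow> real" where
  "evacuation_time A y = max (reach_time A y Robot1) (reach_time A y Robot2)"

text \<open>
  The algorithm, with speeds at most \<open>b\<close>, evacuates both robots if the exit is at \<open>y\<close>. The first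
  two conditions constrain the motion at all times, so that the infima in \<^const>\<open>find_time\<close> and
  \<^const>\<open>reach_time\<close> are attained (trajectories are continuous, the last two conditions make the
  sets nonempty).
\<close>
definition evacuates :: "real \<Rightarrow> algorithm \<Rightarrow> real \<Rightarrow> bool" where
  "evacuates b A y \<longleftrightarrow>
     (\<forall>i. trajectory b (search A i)) \<and>
     (\<forall>i. trajectory b (run A y i)) \<and>
     (\<exists>t\<ge>0. \<exists>i. search A i t = y) \<and>
     (\<forall>i. \<exists>t\<ge>0. run A y i t = y)"

definition makespan_energy :: "real \<Rightarrow> algorithm \<Rightarrow> real \<Rightarrow> real \<Rightarrow> bool" where
  "makespan_energy b A y M \<longleftrightarrow>
     (\<exists>E1 E2. moves b (run A y Robot1) 0 (evacuation_time A y) E1 \<and>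
              moves b (run A y Robot2) 0 (evacuation_time A y) E2 \<and>
              M = max E1 E2)"

text \<open>
  The problem with speed bound \<open>b\<close> and energy budget \<open>\<Delta> d\<close> on instance \<open>d\<close>. The algorithm is fixed
  before \<open>d\<close> and the side of the exit are.
\<close>
definition W_feasible :: "real \<Rightarrow> (real \<Rightarrow> real) \<Rightarrow> algorithm \<Rightarrow> bool" where
  "W_feasible b \<Delta> A \<longleftrightarrow>
     (\<forall>d>0. \<forall>y\<in>{d, - d}. evacuates b A y \<and> (\<exists>M. makespan_energy b A y M \<and> M \<le> \<Delta> d))"

text \<open>The evacuation time on distance \<open>d\<close> is that of the worse of the two placements.\<close>
definition worst_time :: "algorithm \<Rightarrow> real \<Rightarrow> real" where
  "worst_time A d = max (evacuation_time A d) (evacuation_time A (- d))"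

definition W_solution :: "real \<Rightarrow> (real \<Rightarrow> real) \<Rightarrow> algorithm \<Rightarrow> bool" where
  "W_solution b \<Delta> A \<longleftrightarrow>
     W_feasible b \<Delta> A \<and>
     (\<forall>A'. W_feasible b \<Delta> A' \<longrightarrow> (\<forall>d>0. worst_time A d \<le> worst_time A' d))"

definition naive_search :: "real \<Rightarrow> robot \<Rightarrow> real \<Rightarrow> real" where
  "naive_search s i t = (case i of Robot1 \<Rightarrow> s * t | Robot2 \<Rightarrow> - (s * t))"

text \<open>
  At the announcement, at time \<open>\<bar>y\<bar> / s\<close>, the finder is at \<open>y\<close> and halts; the other robot is on the
  opposite side and walks towards \<open>y\<close> at speed \<open>r\<close> until it gets there.
\<close>
definition naive :: "real \<Rightarrow> real \<Rightarrow> algorithm" where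
  "naive s r =
     \<lparr>search = naive_search s,
      respond = (\<lambda>y i u.
        let x = naive_search s i (\<bar>y\<bar> / s)
        in if x = y then y else x + sgn (y - x) * min (r * u) \<bar>y - x\<bar>)\<rparr>"

end

theory Submission
  imports Defs "HOL-Analysis.Lipschitz"
begin

text \<open>
  Let \<open>y\<close> be whichever of \<open>d\<close> and \<open>- d\<close> is visited first during the search, by robot \<open>i\<close> say. If the
  exit is at \<open>- y\<close>, then robot \<open>i\<close> still visits \<open>y\<close> before it learns anything, so it walks from \<open>0\<close>
  to \<open>y\<close> and then to \<open>- y\<close>, a distance of at least \<open>3 * d\<close>. At speed at most \<open>1\<close> this takes time
  \<open>T \<ge> 3 * d\<close>; and as the power \<open>v\<^sup>3\<close> used at speed \<open>v\<close> is convex in \<open>v\<close>, energy is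
  least at constant speed, so that \<open>(3 * d)\<^sup>3 \<le> e * d * T\<^sup>2\<close>. The naive algorithm attains
  whichever of the two bounds on \<open>T\<close> is larger.
\<close>

lemma power_Suc_weighted_add_le:
  fixes u v \<alpha> \<beta> :: real
  assumes nonneg: "0 \<le> u" "0 \<le> v" "0 \<le> \<alpha>" "0 \<le> \<beta>"
  shows "(\<alpha> * u + \<beta> * v) ^ Suc n \<le> (\<alpha> * u ^ Suc n + \<beta> * v ^ Suc n) * (\<alpha> + \<beta>) ^ n"
proof (cases "\<alpha> + \<beta> = 0")
  case True
  then have "\<alpha> = 0" "\<beta> = 0" using nonneg by auto
  then show ?thesis by simp
next
  case False
  then have pos: "0 < \<alpha> + \<beta>" using nonneg by simp
  define t where "t = \<beta> / (\<alpha> + \<beta>)"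
  have t: "0 \<le> t" "t \<le> 1" and \<alpha>: "\<alpha> = (\<alpha> + \<beta>) * (1 - t)" and \<beta>: "\<beta> = (\<alpha> + \<beta>) * t"
    using nonneg pos by (auto simp: t_def field_simps)
  have "convex_on {0::real..} (\<lambda>x. x ^ Suc n)"
    by (cases "even (Suc n)")
      (blast intro: convex_power_odd convex_on_subset[OF convex_power_even] convex_real_interval)+
  from convex_onD[OF this t, of u v] nonneg
  have jensen: "((1 - t) * u + t * v) ^ Suc n \<le> (1 - t) * u ^ Suc n + t * v ^ Suc n"
    by simp
  have "\<alpha> * u + \<beta> * v = (\<alpha> + \<beta>) * ((1 - t) * u + t * v)"
    by (subst \<alpha>, subst \<beta>) (simp only: distrib_left mult.assoc)
  then have "(\<alpha> * u + \<beta> * v) ^ Suc n = (\<alpha> + \<beta>) ^ Suc n * ((1 - t) * u + t * v) ^ Suc n"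
    by (simp only: power_mult_distrib)
  also have "\<dots> \<le> (\<alpha> + \<beta>) ^ Suc n * ((1 - t) * u ^ Suc n + t * v ^ Suc n)"
    using pos by (intro mult_left_mono jensen) simp
  also have "\<dots> = ((\<alpha> + \<beta>) * (1 - t) * u ^ Suc n + (\<alpha> + \<beta>) * t * v ^ Suc n) * (\<alpha> + \<beta>) ^ n"
    by (simp add: algebra_simps)
  finally show ?thesis by (simp only: \<alpha>[symmetric] \<beta>[symmetric])
qed

text \<open>Subadditivity of \<open>(x, \<alpha>) \<mapsto> x ^ Suc n / \<alpha> ^ n\<close>, cleared of denominators to allow \<open>\<alpha> = 0\<close>.\<close>
lemma power_Suc_add_le:
  fixes x y \<alpha> \<beta> E F :: real
  assumes "0 < n" "0 \<le> x" "0 \<le> y" "0 \<le> \<alpha>" "0 \<le> \<beta>" "0 \<le> E" "0 \<le> F"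
    and "x ^ Suc n \<le> E * \<alpha> ^ n" "y ^ Suc n \<le> F * \<beta> ^ n"
  shows "(x + y) ^ Suc n \<le> (E + F) * (\<alpha> + \<beta>) ^ n"
proof -
  have ratio: "\<gamma> * (z / \<gamma>) = z \<and> \<gamma> * (z / \<gamma>) ^ Suc n \<le> G"
    if "0 \<le> \<gamma>" "0 \<le> z" "0 \<le> G" "z ^ Suc n \<le> G * \<gamma> ^ n" for z \<gamma> G :: real
  proof (cases "\<gamma> = 0")
    case True
    then have "z ^ Suc n \<le> 0" using that(4) \<open>0 < n\<close> by (simp add: zero_power)
    then have "z = 0" using that(2) by (metis not_le order_le_less zero_less_power)
    then show ?thesis using that(3) by simp
  next
    case False
    then show ?thesis using that by (simp add: power_divide pos_divide_le_eq)
  qed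
  note ratio_x = ratio[of \<alpha> x E] and ratio_y = ratio[of \<beta> y F]
  have "(x + y) ^ Suc n = (\<alpha> * (x / \<alpha>) + \<beta> * (y / \<beta>)) ^ Suc n"
    using ratio_x ratio_y assms by simp
  also have "\<dots> \<le> (\<alpha> * (x / \<alpha>) ^ Suc n + \<beta> * (y / \<beta>) ^ Suc n) * (\<alpha> + \<beta>) ^ n"
    using assms by (intro power_Suc_weighted_add_le) auto
  also have "\<dots> \<le> (E + F) * (\<alpha> + \<beta>) ^ n"
    using ratio_x ratio_y assms by (intro mult_right_mono add_mono) auto
  finally show ?thesis .
qed

lemma cube_add_le:
  fixes x y \<alpha> \<beta> E F :: real
  assumes "0 \<le> x" "0 \<le> y" "0 \<le> \<alpha>" "0 \<le> \<beta>" "0 \<le> E" "0 \<le> F"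
    and "x ^ 3 \<le> E * \<alpha>\<^sup>2" "y ^ 3 \<le> F * \<beta>\<^sup>2"
  shows "(x + y) ^ 3 \<le> (E + F) * (\<alpha> + \<beta>)\<^sup>2"
  using power_Suc_add_le[of 2 x y \<alpha> \<beta> E F] assms by (simp add: numeral_3_eq_3)

lemma moves_linear:
  assumes "a \<le> c" "\<bar>v\<bar> \<le> b" "\<And>t. a \<le> t \<Longrightarrow> t \<le> c \<Longrightarrow> p t = q + v * (t - a)"
  shows "moves b p a c (\<bar>v\<bar> ^ 3 * (c - a))"
proof -
  have "p a = q" using assms(1) assms(3)[of a] by simp
  then have "moves b p a c (\<bar>p c - p a\<bar> * \<bar>v\<bar>\<^sup>2)"
    using assms by (intro moves.const) auto
  moreover have "\<bar>p c - p a\<bar> = \<bar>v\<bar> * (c - a)"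
    using assms(1) assms(3)[of c] \<open>p a = q\<close> by (simp add: abs_mult)
  ultimately show ?thesis by (simp add: power3_eq_cube power2_eq_square mult_ac)
qed

lemma moves_wait:
  assumes "a \<le> c" "0 \<le> b" "\<And>t. a \<le> t \<Longrightarrow> t \<le> c \<Longrightarrow> p t = q"
  shows "moves b p a c 0"
  using moves_linear[of a c 0 b p q] assms by simp

lemma moves_linear_induct [consumes 1, case_names linear add]:
  assumes "moves b p a c E"
    and "\<And>a c v. a \<le> c \<Longrightarrow> \<bar>v\<bar> \<le> b \<Longrightarrow> (\<And>t. a \<le> t \<Longrightarrow> t \<le> c \<Longrightarrow> p t = p a + v * (t - a)) \<Longrightarrow>
      P a c (\<bar>v\<bar> ^ 3 * (c - a))"
    and "\<And>a m E c F. moves b p a m E \<Longrightarrow> P a m E \<Longrightarrow> moves b p m c F \<Longrightarrow> P m c F \<Longrightarrow> P a c (E + F)"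
  shows "P a c E"
  using assms(1)
proof (induction rule: moves.induct)
  case (const a c v)
  have "\<bar>p c - p a\<bar> * \<bar>v\<bar>\<^sup>2 = \<bar>v\<bar> ^ 3 * (c - a)"
    using const.hyps(1) const.hyps(3)[of c]
    by (simp add: abs_mult power3_eq_cube power2_eq_square mult_ac)
  with assms(2)[OF const.hyps] show ?case by simp
qed (rule assms(3))

lemma moves_mono: "moves b p a c E \<Longrightarrow> a \<le> c"
  by (induction rule: moves.induct) auto

lemma moves_energy_nonneg: "moves b p a c E \<Longrightarrow> 0 \<le> E"
  by (induction rule: moves.induct)
    (blast intro: mult_nonneg_nonneg abs_ge_zero zero_le_power2 add_nonneg_nonneg)+

lemma moves_speed_bound_nonneg: "moves b p a c E \<Longrightarrow> 0 \<le> b"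
  by (induction rule: moves.induct) (blast intro: order_trans abs_ge_zero)+

lemma moves_split:
  assumes "moves b p a c E" "a \<le> m" "m \<le> c"
  obtains E1 E2 where "moves b p a m E1" "moves b p m c E2" "E = E1 + E2"
proof -
  from assms have "\<exists>E1 E2. moves b p a m E1 \<and> moves b p m c E2 \<and> E = E1 + E2"
  proof (induction arbitrary: m rule: moves_linear_induct)
    case (linear a c v)
    have "p t = p m + v * (t - m)" if "m \<le> t" "t \<le> c" for t
      using linear.hyps(3)[of t] linear.hyps(3)[of m] linear.prems that
      by (simp add: algebra_simps)
    then have "moves b p m c (\<bar>v\<bar> ^ 3 * (c - m))"
      by (rule moves_linear[OF linear.prems(2) linear.hyps(2)])
    moreover have "moves b p a m (\<bar>v\<bar> ^ 3 * (m - a))"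
      using linear.prems by (intro moves_linear[OF _ linear.hyps(2,3)]) auto
    moreover have "\<bar>v\<bar> ^ 3 * (c - a) = \<bar>v\<bar> ^ 3 * (m - a) + \<bar>v\<bar> ^ 3 * (c - m)"
      by (simp add: algebra_simps)
    ultimately show ?case by blast
  next
    case (add a k E c F)
    show ?case
    proof (cases "m \<le> k")
      case True
      then obtain E1 E2 where "moves b p a m E1" "moves b p m k E2" "E = E1 + E2"
        using add.IH(1) add.prems by blast
      then show ?thesis
        using moves.add[OF _ add.hyps(2)] by (metis add.assoc)
    next
      case False
      then obtain F1 F2 where "moves b p k m F1" "moves b p m c F2" "F = F1 + F2"
        using add.IH(2) add.prems by (meson linear)
      then show ?thesis
        using moves.add[OF add.hyps(1)] by (metis add.assoc)
    qed
  qed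
  then show thesis using that by blast
qed

lemma moves_displacement_le: "moves b p a c E \<Longrightarrow> \<bar>p c - p a\<bar> \<le> b * (c - a)"
proof (induction rule: moves.induct)
  case (const a c v)
  have "p c - p a = v * (c - a)" using const(3)[of c] const(1) by simp
  then show ?case using const(1,2) by (simp add: abs_mult mult_right_mono)
next
  case (add a m E c F)
  then show ?case by (simp add: algebra_simps)
qed

lemma moves_displacement_cube_le: "moves b p a c E \<Longrightarrow> \<bar>p c - p a\<bar> ^ 3 \<le> E * (c - a)\<^sup>2"
proof (induction rule: moves_linear_induct)
  case (linear a c v)
  have "\<bar>p c - p a\<bar> = \<bar>v\<bar> * (c - a)"
    using linear(1) linear(3)[of c] by (simp add: abs_mult)
  then show ?case by (simp add: power_mult_distrib power3_eq_cube power2_eq_square mult_ac)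
next
  case (add a m E c F)
  have "\<bar>p c - p a\<bar> ^ 3 \<le> (\<bar>p m - p a\<bar> + \<bar>p c - p m\<bar>) ^ 3"
    by (intro power_mono) auto
  also have "\<dots> \<le> (E + F) * (m - a + (c - m))\<^sup>2"
    using add.hyps[THEN moves_mono] add.hyps[THEN moves_energy_nonneg] add.IH
    by (intro cube_add_le) auto
  finally show ?case by simp
qed

lemma moves_detour_le:
  assumes "moves b p a c E" "a \<le> t" "t \<le> u" "u \<le> c"
  shows "\<bar>p t - p a\<bar> + \<bar>p u - p t\<bar> \<le> b * (c - a)"
    and "(\<bar>p t - p a\<bar> + \<bar>p u - p t\<bar>) ^ 3 \<le> E * (c - a)\<^sup>2"
proof -
  obtain E' G where whole: "moves b p a u E'" "moves b p u c G" "E = E' + G"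
    using assms by (meson moves_split order_trans)
  then obtain E1 E2 where legs: "moves b p a t E1" "moves b p t u E2" "E' = E1 + E2"
    using assms by (meson moves_split)
  have "b * (u - a) \<le> b * (c - a)"
    using moves_speed_bound_nonneg[OF assms(1)] assms(4) by (simp add: mult_left_mono)
  with legs(1,2)[THEN moves_displacement_le]
  show "\<bar>p t - p a\<bar> + \<bar>p u - p t\<bar> \<le> b * (c - a)"
    by (simp add: algebra_simps)
  have "(\<bar>p t - p a\<bar> + \<bar>p u - p t\<bar>) ^ 3 \<le> E' * (t - a + (u - t))\<^sup>2"
    unfolding legs(3) using assms(2,3) legs(1,2)[THEN moves_energy_nonneg]
      legs(1,2)[THEN moves_displacement_cube_le]
    by (intro cube_add_le) auto
  also have "\<dots> \<le> E * (c - a)\<^sup>2"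
    using whole(1,2)[THEN moves_energy_nonneg] whole(3) assms(2-4)
    by (intro mult_mono power_mono) auto
  finally show "(\<bar>p t - p a\<bar> + \<bar>p u - p t\<bar>) ^ 3 \<le> E * (c - a)\<^sup>2" .
qed

lemma trajectoryI:
  assumes "p 0 = 0" "\<And>T. K \<le> T \<Longrightarrow> \<exists>E. moves b p 0 T E"
  shows "trajectory b p"
  unfolding trajectory_def
proof (intro conjI allI impI)
  fix T :: real assume "0 \<le> T"
  obtain E where "moves b p 0 (max T K) E" using assms(2)[of "max T K"] by auto
  then show "\<exists>E. moves b p 0 T E" using \<open>0 \<le> T\<close> by (meson max.cobounded1 moves_split)
qed (fact assms(1))

lemma trajectory_lipschitz_on:
  assumes "trajectory b p"
  shows "b-lipschitz_on {0..} p"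
proof (rule lipschitz_on_leI)
  fix t u :: real assume tu: "t \<in> {0..}" "u \<in> {0..}" "t \<le> u"
  then obtain E where "moves b p 0 u E"
    using assms unfolding trajectory_def by (meson atLeast_iff)
  then obtain E' where "moves b p t u E'"
    using tu by (meson atLeast_iff moves_split)
  from moves_displacement_le[OF this] show "dist (p t) (p u) \<le> b * dist t u"
    using tu by (simp add: dist_real_def abs_minus_commute)
next
  show "0 \<le> b" using assms moves_speed_bound_nonneg unfolding trajectory_def by blast
qed

lemma trajectory_closed_visits:
  assumes "trajectory b p"
  shows "closed {t. 0 \<le> t \<and> p t = y}"
proof -
  have "continuous_on {0..} p"
    by (rule lipschitz_on_continuous_on[OF trajectory_lipschitz_on[OF assms]])
  then have "closed ({0..} \<inter> p -` {y})"
    by (intro continuous_closed_preimage) auto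
  moreover have "{0..} \<inter> p -` {y} = {t. 0 \<le> t \<and> p t = y}" by auto
  ultimately show ?thesis by simp
qed

lemma UNIV_robot: "UNIV = {Robot1, Robot2}"
  using robot.exhaust by auto

lemma find_time_le:
  assumes "0 \<le> t" "search A i t = y"
  shows "find_time A y \<le> t"
  unfolding find_time_def using assms by (intro cInf_lower) (auto intro!: bdd_belowI[of _ 0])

lemma find_time_eqI:
  assumes "0 \<le> T" "search A i T = y"
    and "\<And>j t. 0 \<le> t \<Longrightarrow> t < T \<Longrightarrow> search A j t \<noteq> y"
  shows "find_time A y = T"
  unfolding find_time_def using assms by (intro cInf_eq_minimum) (auto simp: not_less[symmetric])

lemma reach_time_eqI:
  assumes "0 \<le> T" "run A y i T = y" "\<And>t. 0 \<le> t \<Longrightarrow> t < T \<Longrightarrow> run A y i t \<noteq> y"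
  shows "reach_time A y i = T"
  unfolding reach_time_def using assms by (intro cInf_eq_minimum) (auto simp: not_less[symmetric])

lemma evacuates_find_time:
  assumes "evacuates b A y"
  obtains i where "0 \<le> find_time A y" "search A i (find_time A y) = y"
proof -
  let ?S = "{t. 0 \<le> t \<and> (\<exists>i. search A i t = y)}"
  have "?S = (\<Union>i. {t. 0 \<le> t \<and> search A i t = y})" by auto
  moreover have "closed (\<Union>i. {t. 0 \<le> t \<and> search A i t = y})"
    using assms by (intro closed_UN)
      (auto simp: evacuates_def UNIV_robot intro: trajectory_closed_visits)
  ultimately have "Inf ?S \<in> ?S"
    using assms by (intro closed_contains_Inf) (auto simp: evacuates_def intro!: bdd_belowI[of _ 0])
  then show thesis using that by (auto simp: find_time_def)
qed

lemma evacuates_reach_time: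
  assumes "evacuates b A y"
  shows "0 \<le> reach_time A y i" "run A y i (reach_time A y i) = y"
proof -
  let ?S = "{t. 0 \<le> t \<and> run A y i t = y}"
  have "closed ?S"
    using assms unfolding evacuates_def by (blast intro: trajectory_closed_visits)
  then have "Inf ?S \<in> ?S"
    using assms by (intro closed_contains_Inf) (auto simp: evacuates_def intro!: bdd_belowI[of _ 0])
  then show "0 \<le> reach_time A y i" "run A y i (reach_time A y i) = y"
    by (simp_all add: reach_time_def)
qed

lemma find_time_le_reach_time:
  assumes "evacuates b A y"
  shows "find_time A y \<le> reach_time A y i"
proof (rule ccontr)
  assume "\<not> ?thesis"
  then have "search A i (reach_time A y i) = y"
    using evacuates_reach_time(2)[OF assms, of i] by (simp add: run_def)
  with \<open>\<not> ?thesis\<close> find_time_le evacuates_reach_time(1)[OF assms] show False by blast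
qed

lemma evacuation_time_eq_max:
  assumes "i \<noteq> j"
  shows "evacuation_time A y = max (reach_time A y i) (reach_time A y j)"
  using assms by (cases i; cases j) (auto simp: evacuation_time_def)

lemma reach_time_le_evacuation_time: "reach_time A y i \<le> evacuation_time A y"
  by (cases i) (auto simp: evacuation_time_def)

lemma evacuation_time_nonneg: "evacuates b A y \<Longrightarrow> 0 \<le> evacuation_time A y"
  using evacuates_reach_time(1) reach_time_le_evacuation_time by (rule order_trans)

lemma makespan_energyI:
  assumes "i \<noteq> j"
    and "moves b (run A y i) 0 (evacuation_time A y) E"
    and "moves b (run A y j) 0 (evacuation_time A y) F"
  shows "makespan_energy b A y (max E F)"
  using assms unfolding makespan_energy_def by (cases i; cases j) (auto, metis max.commute)

lemma makespan_energyE: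
  assumes "makespan_energy b A y M"
  obtains E where "moves b (run A y i) 0 (evacuation_time A y) E" "E \<le> M"
  using assms that unfolding makespan_energy_def by (cases i) auto

lemma later_found_exit_bounds:
  assumes "evacuates b A y" "evacuates b A z" "find_time A y \<le> find_time A z"
    and "makespan_energy b A z M"
  shows "\<bar>y\<bar> + \<bar>z - y\<bar> \<le> b * evacuation_time A z"
    and "(\<bar>y\<bar> + \<bar>z - y\<bar>) ^ 3 \<le> M * (evacuation_time A z)\<^sup>2"
proof -
  obtain i where visit: "0 \<le> find_time A y" "search A i (find_time A y) = y"
    using assms(1) by (rule evacuates_find_time)
  have run: "run A z i 0 = 0" "run A z i (find_time A y) = y" "run A z i (reach_time A z i) = z"
    using assms(2,3) visit(2) evacuates_reach_time(2)[OF assms(2)]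
    by (simp_all add: run_def[of A z i "find_time A y"] evacuates_def trajectory_def)
  obtain E where E: "moves b (run A z i) 0 (evacuation_time A z) E" "E \<le> M"
    using assms(4) by (rule makespan_energyE)
  have "find_time A y \<le> reach_time A z i"
    using assms(3) find_time_le_reach_time[OF assms(2)] by (rule order_trans)
  note detour = moves_detour_le[OF E(1) visit(1) this reach_time_le_evacuation_time, unfolded run]
  show "\<bar>y\<bar> + \<bar>z - y\<bar> \<le> b * evacuation_time A z"
    using detour(1) by simp
  have "E * (evacuation_time A z)\<^sup>2 \<le> M * (evacuation_time A z)\<^sup>2"
    using E(2) by (rule mult_right_mono) simp
  with detour(2) show "(\<bar>y\<bar> + \<bar>z - y\<bar>) ^ 3 \<le> M * (evacuation_time A z)\<^sup>2"
    by simp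
qed

lemma W_feasible_worst_time_bounds:
  assumes "W_feasible b \<Delta> A" "0 < d"
  shows "3 * d \<le> b * worst_time A d"
    and "(3 * d) ^ 3 \<le> \<Delta> d * (worst_time A d)\<^sup>2"
proof -
  have "\<exists>y\<in>{d, - d}. find_time A y \<le> find_time A (- y)" by force
  then obtain y where y: "y \<in> {d, - d}" "- y \<in> {d, - d}" "find_time A y \<le> find_time A (- y)"
    by force
  have evacuates: "evacuates b A y" "evacuates b A (- y)"
    using assms y(1,2) unfolding W_feasible_def by blast+
  obtain M where M: "makespan_energy b A (- y) M" "M \<le> \<Delta> d"
    using assms y(2) unfolding W_feasible_def by blast
  let ?T = "evacuation_time A (- y)"
  have length: "\<bar>y\<bar> + \<bar>- y - y\<bar> = 3 * d" using y(1) assms(2) by auto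
  note bounds = later_found_exit_bounds[OF evacuates y(3) M(1), unfolded length]
  obtain E where moves: "moves b (run A (- y) Robot1) 0 ?T E" "E \<le> M"
    using M(1) by (rule makespan_energyE)
  note nonneg = moves_speed_bound_nonneg[OF moves(1)] moves_mono[OF moves(1)]
    moves_energy_nonneg[OF moves(1)]
  have T_le: "?T \<le> worst_time A d"
    using y(2) by (auto simp: worst_time_def)
  show "3 * d \<le> b * worst_time A d"
    using bounds(1) mult_left_mono[OF T_le nonneg(1)] by simp
  have "M * ?T\<^sup>2 \<le> \<Delta> d * (worst_time A d)\<^sup>2"
    using M(2) moves(2) T_le nonneg by (intro mult_mono power_mono) auto
  with bounds(2) show "(3 * d) ^ 3 \<le> \<Delta> d * (worst_time A d)\<^sup>2" by simp
qed

lemma W_feasible_linear_budget_worst_time_ge: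
  assumes "W_feasible b (\<lambda>d. e * d) A" "0 < e" "0 < d"
  shows "3 * sqrt (3 / e) * d \<le> worst_time A d"
proof (rule power2_le_imp_le)
  have "(3 * sqrt (3 / e) * d)\<^sup>2 = (3 * d) ^ 3 / (e * d)"
    using assms(2,3) by (simp add: power_mult_distrib power3_eq_cube) (simp add: power2_eq_square)
  also have "\<dots> \<le> (worst_time A d)\<^sup>2"
    using W_feasible_worst_time_bounds(2)[OF assms(1,3)] assms(2,3)
    by (simp add: pos_divide_le_eq mult.commute)
  finally show "(3 * sqrt (3 / e) * d)\<^sup>2 \<le> (worst_time A d)\<^sup>2" .
  have "evacuates b A d" using assms(1,3) by (simp add: W_feasible_def)
  then show "0 \<le> worst_time A d"
    unfolding worst_time_def by (simp add: evacuation_time_nonneg le_max_iff_disj)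
qed

definition heading :: "robot \<Rightarrow> real" where
  "heading i = (case i of Robot1 \<Rightarrow> 1 | Robot2 \<Rightarrow> - 1)"

lemma search_naive: "search (naive s r) i t = heading i * (s * t)"
  by (cases i) (simp_all add: naive_def naive_search_def heading_def)

lemma respond_naive:
  "respond (naive s r) y i u =
    (let x = heading i * (s * (\<bar>y\<bar> / s))
     in if x = y then y else x + sgn (y - x) * min (r * u) \<bar>y - x\<bar>)"
  by (cases i) (simp_all add: naive_def naive_search_def heading_def)

lemma heading_eq_sgn: "y \<noteq> 0 \<Longrightarrow> heading i = sgn y \<or> heading i = - sgn y"
  by (cases i) (auto simp: heading_def sgn_if)

lemma obtain_finder_and_other:
  assumes "y \<noteq> 0"
  obtains i j where "i \<noteq> j" "heading i = sgn y" "heading j = - sgn y"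
  using assms that[of Robot1 Robot2] that[of Robot2 Robot1]
  by (cases "0 < y") (auto simp: heading_def)

lemma find_time_naive:
  assumes "0 < s" "y \<noteq> 0"
  shows "find_time (naive s r) y = \<bar>y\<bar> / s"
proof -
  obtain i where "heading i = sgn y" using obtain_finder_and_other[OF assms(2)] .
  show ?thesis
  proof (rule find_time_eqI)
    show "search (naive s r) i (\<bar>y\<bar> / s) = y"
      using assms \<open>heading i = sgn y\<close> by (simp add: search_naive sgn_mult_abs)
    fix j t assume "0 \<le> t" "t < \<bar>y\<bar> / s"
    then have "0 \<le> s * t" "s * t < \<bar>y\<bar>" using assms(1) by (simp_all add: field_simps)
    then show "search (naive s r) j t \<noteq> y"
      by (cases j) (auto simp: search_naive heading_def)
  qed (use assms in simp)
qed

lemma run_naive_finder: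
  assumes "0 < s" "y \<noteq> 0" "heading i = sgn y"
  shows "run (naive s r) y i t = (if t \<le> \<bar>y\<bar> / s then sgn y * (s * t) else y)"
  using assms
  by (simp add: run_def find_time_naive search_naive respond_naive sgn_mult_abs)

lemma run_naive_other:
  assumes "0 < s" "y \<noteq> 0" "heading j = - sgn y"
  shows "run (naive s r) y j t =
    (if t \<le> \<bar>y\<bar> / s then - (sgn y * (s * t))
     else sgn y * min (r * (t - \<bar>y\<bar> / s)) (2 * \<bar>y\<bar>) - y)"
proof -
  have "heading j * (s * (\<bar>y\<bar> / s)) = - y" "sgn (y - - y) = sgn y" "\<bar>y - - y\<bar> = 2 * \<bar>y\<bar>"
    using assms by (simp_all add: sgn_mult_abs sgn_if)
  moreover have "- y \<noteq> y" using assms(2) by simp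
  ultimately have "respond (naive s r) y j u = sgn y * min (r * u) (2 * \<bar>y\<bar>) - y" for u
    by (simp add: respond_naive)
  then show ?thesis
    using assms by (simp add: run_def find_time_naive search_naive)
qed

lemma reach_time_naive_finder:
  assumes "0 < s" "y \<noteq> 0" "heading i = sgn y"
  shows "reach_time (naive s r) y i = \<bar>y\<bar> / s"
proof (rule reach_time_eqI)
  fix t assume "0 \<le> t" "t < \<bar>y\<bar> / s"
  then have "\<bar>sgn y * (s * t)\<bar> < \<bar>y\<bar>" using assms by (simp add: abs_mult field_simps)
  then show "run (naive s r) y i t \<noteq> y"
    using \<open>t < \<bar>y\<bar> / s\<close> by (auto simp: run_naive_finder[OF assms])
qed (use assms in \<open>simp_all add: run_naive_finder sgn_mult_abs\<close>)

lemma run_naive_other_arrived: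
  assumes "0 < s" "0 < r" "y \<noteq> 0" "heading j = - sgn y" "\<bar>y\<bar> / s + 2 * \<bar>y\<bar> / r \<le> t"
  shows "run (naive s r) y j t = y"
proof -
  have "2 * \<bar>y\<bar> \<le> r * (t - \<bar>y\<bar> / s)"
    using assms(2,5) by (simp add: field_simps)
  moreover have "0 < 2 * \<bar>y\<bar> / r" using assms by simp
  then have "\<not> t \<le> \<bar>y\<bar> / s" using assms(5) by linarith
  ultimately show ?thesis
    by (simp add: run_naive_other[OF assms(1,3,4)] sgn_mult_abs min_absorb2 mult.left_commute)
qed

lemma reach_time_naive_other:
  assumes "0 < s" "0 < r" "y \<noteq> 0" "heading j = - sgn y"
  shows "reach_time (naive s r) y j = \<bar>y\<bar> / s + 2 * \<bar>y\<bar> / r"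
proof (rule reach_time_eqI)
  fix t assume t: "0 \<le> t" "t < \<bar>y\<bar> / s + 2 * \<bar>y\<bar> / r"
  then have "0 \<le> s * t" "r * (t - \<bar>y\<bar> / s) < 2 * \<bar>y\<bar>"
    using assms(1,2) by (simp_all add: field_simps)
  then show "run (naive s r) y j t \<noteq> y"
    using assms(3) by (auto simp: run_naive_other[OF assms(1,3,4)] sgn_if)
qed (use assms in \<open>simp_all add: run_naive_other_arrived\<close>)

lemma evacuation_time_naive:
  assumes "0 < s" "0 < r" "y \<noteq> 0"
  shows "evacuation_time (naive s r) y = \<bar>y\<bar> / s + 2 * \<bar>y\<bar> / r"
proof -
  obtain i j where "i \<noteq> j" "heading i = sgn y" "heading j = - sgn y"
    using obtain_finder_and_other[OF assms(3)] .
  then show ?thesis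
    using assms
    by (simp add: evacuation_time_eq_max reach_time_naive_finder reach_time_naive_other max_def)
qed

lemma moves_naive_finder:
  assumes "0 < s" "s \<le> b" "y \<noteq> 0" "heading i = sgn y" "\<bar>y\<bar> / s \<le> T"
  shows "moves b (run (naive s r) y i) 0 T (s\<^sup>2 * \<bar>y\<bar>)"
proof -
  let ?p = "run (naive s r) y i" and ?t = "\<bar>y\<bar> / s"
  note run = run_naive_finder[OF assms(1,3,4)]
  have speed: "\<bar>sgn y * s\<bar> = s" using assms by (simp add: abs_mult)
  have "moves b ?p 0 ?t (\<bar>sgn y * s\<bar> ^ 3 * (?t - 0))"
    using assms speed by (intro moves_linear[where q = 0]) (auto simp: run)
  moreover have "moves b ?p ?t T 0"
    using assms by (intro moves_wait[where q = y]) (auto simp: run sgn_mult_abs)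
  ultimately have "moves b ?p 0 T (\<bar>sgn y * s\<bar> ^ 3 * (?t - 0) + 0)"
    by (rule moves.add)
  moreover have "\<bar>sgn y * s\<bar> ^ 3 * (?t - 0) + 0 = s\<^sup>2 * \<bar>y\<bar>"
    using assms(1) unfolding speed by (simp add: power3_eq_cube power2_eq_square)
  ultimately show ?thesis by simp
qed

lemma moves_naive_other:
  assumes "0 < s" "s \<le> b" "0 < r" "r \<le> b" "y \<noteq> 0" "heading j = - sgn y"
    and "\<bar>y\<bar> / s + 2 * \<bar>y\<bar> / r \<le> T"
  shows "moves b (run (naive s r) y j) 0 T ((s\<^sup>2 + 2 * r\<^sup>2) * \<bar>y\<bar>)"
proof -
  let ?p = "run (naive s r) y j" and ?t = "\<bar>y\<bar> / s"
  let ?u = "?t + 2 * \<bar>y\<bar> / r"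
  note run = run_naive_other[OF assms(1,5,6)]
  have speed: "\<bar>- sgn y * s\<bar> = s" "\<bar>sgn y * r\<bar> = r" using assms by (simp_all add: abs_mult)
  have outward: "moves b ?p 0 ?t (\<bar>- sgn y * s\<bar> ^ 3 * (?t - 0))"
    using assms speed by (intro moves_linear[where q = 0]) (auto simp: run)
  have inward: "moves b ?p ?t ?u (\<bar>sgn y * r\<bar> ^ 3 * (?u - ?t))"
  proof (rule moves_linear[where q = "- y"])
    fix t assume t: "?t \<le> t" "t \<le> ?u"
    then have "r * (t - ?t) \<le> 2 * \<bar>y\<bar>" using assms(3) by (simp add: field_simps)
    then show "?p t = - y + sgn y * r * (t - ?t)"
      using t assms(1) by (cases "t = ?t") (auto simp: run sgn_mult_abs)
  qed (use assms speed in auto)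
  have halt: "moves b ?p ?u T 0"
    using assms by (intro moves_wait[where q = y]) (auto simp: run_naive_other_arrived)
  have "\<bar>- sgn y * s\<bar> ^ 3 * (?t - 0) + \<bar>sgn y * r\<bar> ^ 3 * (?u - ?t) + 0 = (s\<^sup>2 + 2 * r\<^sup>2) * \<bar>y\<bar>"
    using assms(1,3) unfolding speed
    by (simp add: power3_eq_cube power2_eq_square algebra_simps)
  with moves.add[OF moves.add[OF outward inward] halt] show ?thesis by simp
qed

lemma trajectory_search_naive:
  assumes "0 < s" "s \<le> b"
  shows "trajectory b (search (naive s r) i)"
proof (rule trajectoryI[where K = 0])
  fix T :: real assume "0 \<le> T"
  moreover have "\<bar>heading i * s\<bar> \<le> b" using assms by (cases i) (simp_all add: heading_def)
  ultimately have "moves b (search (naive s r) i) 0 T (\<bar>heading i * s\<bar> ^ 3 * (T - 0))"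
    by (intro moves_linear[where q = 0]) (auto simp: search_naive)
  then show "\<exists>E. moves b (search (naive s r) i) 0 T E" by blast
qed (simp add: search_naive)

lemma trajectory_run_naive:
  assumes "0 < s" "s \<le> b" "0 < r" "r \<le> b" "y \<noteq> 0"
  shows "trajectory b (run (naive s r) y i)"
proof (rule trajectoryI[where K = "\<bar>y\<bar> / s + 2 * \<bar>y\<bar> / r"])
  show "run (naive s r) y i 0 = 0"
    using assms by (simp add: run_def find_time_naive search_naive)
  fix T assume T: "\<bar>y\<bar> / s + 2 * \<bar>y\<bar> / r \<le> T"
  have "0 \<le> 2 * \<bar>y\<bar> / r" using assms(3) by simp
  with T have "\<bar>y\<bar> / s \<le> T" by linarith
  with T show "\<exists>E. moves b (run (naive s r) y i) 0 T E"
    using heading_eq_sgn[OF assms(5), of i] moves_naive_finder[OF assms(1,2,5)]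
      moves_naive_other[OF assms] by blast
qed

lemma evacuates_naive:
  assumes "0 < s" "s \<le> b" "0 < r" "r \<le> b" "y \<noteq> 0"
  shows "evacuates b (naive s r) y"
proof -
  let ?t = "\<bar>y\<bar> / s" and ?u = "\<bar>y\<bar> / s + 2 * \<bar>y\<bar> / r"
  have nonneg: "0 \<le> ?t" "0 \<le> ?u" using assms by simp_all
  obtain i where "heading i = sgn y" using obtain_finder_and_other[OF assms(5)] .
  then have "search (naive s r) i ?t = y"
    using assms by (simp add: search_naive sgn_mult_abs)
  moreover have "\<exists>t\<ge>0. run (naive s r) y i t = y" for i
    using heading_eq_sgn[OF assms(5), of i]
  proof
    assume "heading i = sgn y"
    then have "run (naive s r) y i ?t = y"
      using assms by (simp add: run_naive_finder sgn_mult_abs)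
    then show ?thesis using nonneg(1) by blast
  next
    assume "heading i = - sgn y"
    then have "run (naive s r) y i ?u = y"
      using assms by (simp add: run_naive_other_arrived)
    then show ?thesis using nonneg(2) by blast
  qed
  ultimately show ?thesis
    unfolding evacuates_def
    using trajectory_search_naive[OF assms(1,2)] trajectory_run_naive[OF assms] nonneg(1) by blast
qed

lemma makespan_energy_naive:
  assumes "0 < s" "s \<le> b" "0 < r" "r \<le> b" "y \<noteq> 0"
  shows "makespan_energy b (naive s r) y ((s\<^sup>2 + 2 * r\<^sup>2) * \<bar>y\<bar>)"
proof -
  obtain i j where "i \<noteq> j" and heading: "heading i = sgn y" "heading j = - sgn y"
    using obtain_finder_and_other[OF assms(5)] .
  have T: "evacuation_time (naive s r) y = \<bar>y\<bar> / s + 2 * \<bar>y\<bar> / r"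
    using assms by (intro evacuation_time_naive)
  have "makespan_energy b (naive s r) y (max (s\<^sup>2 * \<bar>y\<bar>) ((s\<^sup>2 + 2 * r\<^sup>2) * \<bar>y\<bar>))"
    using assms heading
    by (intro makespan_energyI[OF \<open>i \<noteq> j\<close>] moves_naive_finder moves_naive_other) (simp_all add: T)
  then show ?thesis by (simp add: max_absorb2 mult_right_mono)
qed

lemma W_feasible_naive:
  assumes "0 < s" "s \<le> b" "0 < r" "r \<le> b" "\<And>d. 0 < d \<Longrightarrow> (s\<^sup>2 + 2 * r\<^sup>2) * d \<le> \<Delta> d"
  shows "W_feasible b \<Delta> (naive s r)"
  unfolding W_feasible_def
proof (intro allI impI ballI conjI)
  fix d y :: real assume "0 < d" "y \<in> {d, - d}"
  then have y: "y \<noteq> 0" "\<bar>y\<bar> = d" by auto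
  show "evacuates b (naive s r) y"
    using assms(1-4) y(1) by (rule evacuates_naive)
  show "\<exists>M. makespan_energy b (naive s r) y M \<and> M \<le> \<Delta> d"
    using makespan_energy_naive[OF assms(1-4) y(1)] assms(5)[OF \<open>0 < d\<close>] y(2) by auto
qed

theorem theorem7:
  fixes e s r :: real and g :: "real \<Rightarrow> real"
  assumes "e > 0"
    and "s = (if e < 3 then sqrt (e / 3) else 1)"
    and "r = s"
    and "g = (\<lambda>e. if e < 3 then 3 * sqrt (3 / e) else 3)"
  shows "W_solution 1 (\<lambda>d. e * d) (naive s r) \<and>
    (\<forall>d>0. \<forall>y\<in>{d, - d}. evacuation_time (naive s r) y = g e * d)"
proof -
  have s: "0 < s" "s \<le> 1" "s\<^sup>2 + 2 * s\<^sup>2 \<le> e" and g: "g e = 3 / s"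
    using assms(1,2,4) by (auto simp: real_sqrt_divide power_divide)
  have time: "evacuation_time (naive s r) y = g e * d" if "0 < d" "y \<in> {d, - d}" for d y
    using that s(1) by (auto simp: evacuation_time_naive g assms(3) field_simps)
  have "W_feasible 1 (\<lambda>d. e * d) (naive s r)"
    using s by (simp add: assms(3) W_feasible_naive mult_right_mono)
  moreover have "worst_time (naive s r) d \<le> worst_time A d"
    if "W_feasible 1 (\<lambda>d. e * d) A" "0 < d" for A d
    using W_feasible_worst_time_bounds(1)[OF that] time[OF that(2)]
      W_feasible_linear_budget_worst_time_ge[OF that(1) assms(1) that(2)]
    by (simp add: worst_time_def[of "naive s r"] assms(4))
  ultimately show ?thesis
    unfolding W_solution_def using time by blast
qed

end
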